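(* Let $L$ be a lattice of signature $(2,b)$ and $\Gamma$ a finite-index subgroup of $O^+(L)$. The group $\Gamma$ has no irregular cusp when $-\mathrm{id}\in\Gamma$, or when $\Gamma$ is neat, or when $\Gamma<SO^+(L)$ with $b$ odd.
   Context: A lattice is a free $\mathbb{Z}$-module of finite rank with a nondegenerate integral symmetric bilinear form $(\cdot,\cdot)$. $\mathcal{D}$ is a fixed connected component (of two) of $\{\mathbb{C}\omega\in\mathbb{P}L_{\mathbb{C}}:(\omega,\omega)=0,(\omega,\bar\omega)>0\}$; $O^+(L)$, $O^+(L_{\mathbb{Q}})$ are the subgroups of $O(L)$, $O(L_{\mathbb{Q}})$ preserving $\mathcal{D}$, and $SO^+(L)=O^+(L)\cap SO(L)$. $\Gamma$ is neat if for every $\gamma\in\Gamma$ the subgroup of $\mathbb{C}^\times$ generated by the eigenvalues of $\gamma$ is torsion-free. Let $\langle\Gamma,-\mathrm{id}\rangle$ be the group generated by $\Gamma$ and $-\mathrm{id}$. A $0$-dimensional cusp is a rank $1$ primitive isotropic sublattice $I\subset L$. Let $U(I)_{\mathbb{Q}}$ be the group of $g\in O^+(L_{\mathbb{Q}})$ which preserve $I$ and act trivially on $I$ and on $I_{\mathbb{Q}}^\perp/I_{\mathbb{Q}}$. The cusp $I$ is irregular for $\Gamma$ if $U(I)_{\mathbb{Q}}\cap\Gamma\neq U(I)_{\mathbb{Q}}\cap\langle\Gamma,-\mathrm{id}\rangle$. A $1$-dimensional cusp is a rank $2$ primitive isotropic sublattice $J\subset L$. Let $U(J)_{\mathbb{Q}}$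 be the group of $g\in O^+(L_{\mathbb{Q}})$ acting trivially on $J_{\mathbb{Q}}^\perp$. The cusp $J$ is irregular for $\Gamma$ if $U(J)_{\mathbb{Q}}\cap\Gamma\ne U(J)_{\mathbb{Q}}\cap\langle\Gamma,-\mathrm{id}\rangle$. "$\Gamma$ has no irregular cusp" means that no $0$- or $1$-dimensional cusp is irregular for $\Gamma$. *)

theory Defs
  imports "HOL-Analysis.Analysis" "HOL-Algebra.Generated_Groups"
begin

section \<open>Lattices and their scalar extensions\<close>

text \<open>A lattice of rank \<open>CARD('n)\<close> is given, after the choice of a basis, by its Gram matrix
  \<open>G\<close>. For \<open>'a\<close> one of \<open>int\<close>, \<open>rat\<close>, \<open>real\<close>, \<open>complex\<close>, \<open>bform G\<close> is the (bilinear) extension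
  of the form to the scalars \<open>'a\<close>.\<close>

definition bform :: "int^'n^'n \<Rightarrow> 'a::comm_ring_1^'n \<Rightarrow> 'a^'n \<Rightarrow> 'a" where
  "bform G x y = (\<Sum>i\<in>UNIV. \<Sum>j\<in>UNIV. x $ i * of_int (G $ i $ j) * y $ j)"

definition lattice_form :: "int^'n^'n \<Rightarrow> bool" where
  "lattice_form G \<longleftrightarrow>
     (\<forall>x y :: int^'n. bform G x y = bform G y x) \<and>
     (\<forall>x :: int^'n. (\<forall>y. bform G x y = 0) \<longrightarrow> x = 0)"

text \<open>Signature in the sense of Sylvester, read off from an orthogonal basis \<open>e\<close> of the real
  extension. For a nondegenerate form \<open>p + q\<close> is necessarily the rank.\<close>

definition has_signature :: "int^'n^'n \<Rightarrow> nat \<Rightarrow> nat \<Rightarrow> bool" where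
  "has_signature G p q \<longleftrightarrow>
     (\<exists>e :: 'n \<Rightarrow> real^'n. inj e \<and> independent (range e) \<and>
        (\<forall>i j. i \<noteq> j \<longrightarrow> bform G (e i) (e j) = 0) \<and>
        card {i. bform G (e i) (e i) > 0} = p \<and>
        card {i. bform G (e i) (e i) < 0} = q)"

text \<open>The lattice itself, as the subgroup of integral vectors of the rational quadratic space.\<close>

definition lat :: "(rat^'n) set" where
  "lat = {x. \<forall>i. x $ i \<in> \<int>}"


section \<open>The period domain\<close>

definition proj_space :: "(complex^'n) set set" where
  "proj_space = {vec.span {v} | v. v \<noteq> 0}"

definition proj_topology :: "(complex^'n) set topology" where
  "proj_topology = topology (\<lambda>U. U \<subseteq> proj_space \<and> open {v. v \<noteq> 0 \<and> vec.span {v} \<in> U})"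

lemma openin_proj_topology:
  "openin proj_topology U \<longleftrightarrow>
     U \<subseteq> proj_space \<and> open {v :: complex^'n. v \<noteq> 0 \<and> vec.span {v} \<in> U}"
proof -
  have "istopology (\<lambda>U. U \<subseteq> proj_space \<and> open {v :: complex^'n. v \<noteq> 0 \<and> vec.span {v} \<in> U})"
    unfolding istopology_def
  proof (intro conjI allI impI)
    fix S T :: "(complex^'n) set set"
    assume S: "S \<subseteq> proj_space \<and> open {v. v \<noteq> 0 \<and> vec.span {v} \<in> S}"
      and T: "T \<subseteq> proj_space \<and> open {v. v \<noteq> 0 \<and> vec.span {v} \<in> T}"
    show "S \<inter> T \<subseteq> proj_space" using S by blast
    have eq: "{v. v \<noteq> 0 \<and> vec.span {v} \<in> S \<inter> T} =
        {v. v \<noteq> 0 \<and> vec.span {v} \<in> S} \<inter> {v. v \<noteq> 0 \<and> vec.span {v} \<in> T}" by auto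
    then show "open {v. v \<noteq> 0 \<and> vec.span {v} \<in> S \<inter> T}" unfolding eq using S T by (intro open_Int) (rule conjunct2, assumption)+
  next
    fix K :: "(complex^'n) set set set"
    assume K: "\<forall>S\<in>K. S \<subseteq> proj_space \<and> open {v. v \<noteq> 0 \<and> vec.span {v} \<in> S}"
    show "\<Union> K \<subseteq> proj_space" using K by blast
    have eq: "{v. v \<noteq> 0 \<and> vec.span {v} \<in> \<Union> K} = (\<Union>S\<in>K. {v. v \<noteq> 0 \<and> vec.span {v} \<in> S})" by auto
    then show "open {v. v \<noteq> 0 \<and> vec.span {v} \<in> \<Union> K}" unfolding eq using K by (intro open_UN) blast
  qed
  then show ?thesis by (simp add: proj_topology_def)
qed

lemma topspace_proj_topology: "topspace proj_topology = (proj_space :: (complex^'n) set set)"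
proof -
  have "{v :: complex^'n. v \<noteq> 0 \<and> vec.span {v} \<in> proj_space} = - {0}"
    by (auto simp: proj_space_def)
  then have "openin proj_topology (proj_space :: (complex^'n) set set)"
    by (simp add: openin_proj_topology open_Compl)
  then show ?thesis
    using openin_proj_topology[of "topspace proj_topology"] openin_subset by fastforce
qed

lemma quotient_map_proj:
  "quotient_map (top_of_set (- {0 :: complex^'n})) proj_topology (\<lambda>v. vec.span {v})"
proof -
  have "open (- {0 :: complex^'n})" by (simp add: open_Compl)
  then have *: "openin (top_of_set (- {0 :: complex^'n})) S \<longleftrightarrow> S \<subseteq> - {0} \<and> open S" for S
    by (auto simp: openin_open_eq)
  show ?thesis
    unfolding quotient_map_def
  proof (intro conjI allI impI)
    show "(\<lambda>v. vec.span {v}) ` topspace (top_of_set (- {0 :: complex^'n})) = topspace proj_topology"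
      by (auto simp: topspace_proj_topology proj_space_def)
    fix U :: "(complex^'n) set set"
    assume "U \<subseteq> topspace proj_topology"
    moreover have "{x \<in> topspace (top_of_set (- {0 :: complex^'n})). vec.span {x} \<in> U} =
        {v. v \<noteq> 0 \<and> vec.span {v} \<in> U}" by simp
    moreover have "{v :: complex^'n. v \<noteq> 0 \<and> vec.span {v} \<in> U} \<subseteq> - {0}" by blast
    ultimately show "openin (top_of_set (- {0})) {x \<in> topspace (top_of_set (- {0})). vec.span {x} \<in> U} =
        openin proj_topology U"
      by (simp only: * openin_proj_topology topspace_proj_topology simp_thms)
  qed
qed

definition cnj_vec :: "complex^'n \<Rightarrow> complex^'n" where
  "cnj_vec v = (\<chi> i. cnj (v $ i))"

text \<open>The number \<open>bform G \<omega> (cnj_vec \<omega>)\<close> is real because \<open>G\<close> is symmetric, so \<open>Re\<close> discards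
  nothing.\<close>

definition period_quadric :: "int^'n^'n \<Rightarrow> (complex^'n) set set" where
  "period_quadric G = {vec.span {\<omega>} | \<omega>. \<omega> \<noteq> 0 \<and>
     bform G \<omega> \<omega> = 0 \<and> Re (bform G \<omega> (cnj_vec \<omega>)) > 0}"

definition period_domain :: "int^'n^'n \<Rightarrow> (complex^'n) set set \<Rightarrow> bool" where
  "period_domain G D \<longleftrightarrow>
     D \<in> connected_components_of (subtopology proj_topology (period_quadric G))"


section \<open>Orthogonal groups\<close>

definition cmat :: "rat^'n^'n \<Rightarrow> complex^'n^'n" where
  "cmat g = (\<chi> i j. of_rat (g $ i $ j))"

definition orth_Q :: "int^'n^'n \<Rightarrow> (rat^'n^'n) set" where
  "orth_Q G = {g. invertible g \<and> (\<forall>x y. bform G (g *v x) (g *v y) = bform G x y)}"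

definition preserves_domain :: "(complex^'n) set set \<Rightarrow> rat^'n^'n \<Rightarrow> bool" where
  "preserves_domain D g \<longleftrightarrow> (\<lambda>l. (\<lambda>v. cmat g *v v) ` l) ` D = D"

definition orth_plus_Q :: "int^'n^'n \<Rightarrow> (complex^'n) set set \<Rightarrow> (rat^'n^'n) set" where
  "orth_plus_Q G D = {g \<in> orth_Q G. preserves_domain D g}"

text \<open>Isometries of the lattice are regarded as those isometries of the rational quadratic space
  which map the lattice onto itself.\<close>

definition orth_L :: "int^'n^'n \<Rightarrow> (rat^'n^'n) set" where
  "orth_L G = {g \<in> orth_Q G. (\<lambda>x. g *v x) ` lat = lat}"

definition orth_plus_L :: "int^'n^'n \<Rightarrow> (complex^'n) set set \<Rightarrow> (rat^'n^'n) set" where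
  "orth_plus_L G D = {g \<in> orth_L G. preserves_domain D g}"

definition sorth_L :: "int^'n^'n \<Rightarrow> (rat^'n^'n) set" where
  "sorth_L G = {g \<in> orth_L G. det g = 1}"

definition sorth_plus_L :: "int^'n^'n \<Rightarrow> (complex^'n) set set \<Rightarrow> (rat^'n^'n) set" where
  "sorth_plus_L G D = orth_plus_L G D \<inter> sorth_L G"

definition mat_group :: "(rat^'n^'n) set \<Rightarrow> (rat^'n^'n) monoid" where
  "mat_group S = \<lparr>carrier = S, mult = (**), one = mat 1\<rparr>"

definition with_neg_id ::
    "int^'n^'n \<Rightarrow> (complex^'n) set set \<Rightarrow> (rat^'n^'n) set \<Rightarrow> (rat^'n^'n) set" where
  "with_neg_id G D \<Gamma> = generate (mat_group (orth_plus_L G D)) (insert (- mat 1) \<Gamma>)"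


section \<open>Neat groups\<close>

definition eigenvalues :: "rat^'n^'n \<Rightarrow> complex set" where
  "eigenvalues g = {c. \<exists>v. v \<noteq> 0 \<and> cmat g *v v = c *s v}"

definition complex_units :: "complex monoid" where
  "complex_units = \<lparr>carrier = - {0}, mult = (*), one = 1\<rparr>"

definition torsion_free :: "('a, 'b) monoid_scheme \<Rightarrow> 'a set \<Rightarrow> bool" where
  "torsion_free A H \<longleftrightarrow> (\<forall>x\<in>H. \<forall>n::nat. n > 0 \<longrightarrow> x [^]\<^bsub>A\<^esub> n = \<one>\<^bsub>A\<^esub> \<longrightarrow> x = \<one>\<^bsub>A\<^esub>)"

definition neat :: "(rat^'n^'n) set \<Rightarrow> bool" where
  "neat \<Gamma> \<longleftrightarrow> (\<forall>\<gamma>\<in>\<Gamma>. torsion_free complex_units (generate complex_units (eigenvalues \<gamma>)))"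


section \<open>Cusps\<close>

definition sublattice :: "(rat^'n) set \<Rightarrow> bool" where
  "sublattice I \<longleftrightarrow> I \<subseteq> lat \<and> 0 \<in> I \<and> (\<forall>x\<in>I. \<forall>y\<in>I. x - y \<in> I)"

text \<open>Primitive: the quotient of the lattice by \<open>I\<close> is torsion-free.\<close>

definition primitive_in_lat :: "(rat^'n) set \<Rightarrow> bool" where
  "primitive_in_lat I \<longleftrightarrow> (\<forall>x\<in>lat. \<forall>k::int. k \<noteq> 0 \<longrightarrow> of_int k *s x \<in> I \<longrightarrow> x \<in> I)"

definition isotropic :: "int^'n^'n \<Rightarrow> (rat^'n) set \<Rightarrow> bool" where
  "isotropic G I \<longleftrightarrow> (\<forall>x\<in>I. \<forall>y\<in>I. bform G x y = 0)"

text \<open>The rank of \<open>I\<close> is the dimension of its rational span.\<close>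

definition cusp :: "int^'n^'n \<Rightarrow> nat \<Rightarrow> (rat^'n) set \<Rightarrow> bool" where
  "cusp G r I \<longleftrightarrow> sublattice I \<and> primitive_in_lat I \<and> isotropic G I \<and> vec.dim I = r"

definition perp_Q :: "int^'n^'n \<Rightarrow> (rat^'n) set \<Rightarrow> (rat^'n) set" where
  "perp_Q G I = {v. \<forall>w\<in>vec.span I. bform G v w = 0}"

definition U_cusp0 ::
    "int^'n^'n \<Rightarrow> (complex^'n) set set \<Rightarrow> (rat^'n) set \<Rightarrow> (rat^'n^'n) set" where
  "U_cusp0 G D I = {g \<in> orth_plus_Q G D.
     (\<lambda>x. g *v x) ` I = I \<and> (\<forall>x\<in>I. g *v x = x) \<and>
     (\<forall>v\<in>perp_Q G I. g *v v - v \<in> vec.span I)}"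

definition U_cusp1 ::
    "int^'n^'n \<Rightarrow> (complex^'n) set set \<Rightarrow> (rat^'n) set \<Rightarrow> (rat^'n^'n) set" where
  "U_cusp1 G D J = {g \<in> orth_plus_Q G D. \<forall>v\<in>perp_Q G J. g *v v = v}"

definition irregular_cusp0 ::
    "int^'n^'n \<Rightarrow> (complex^'n) set set \<Rightarrow> (rat^'n^'n) set \<Rightarrow> (rat^'n) set \<Rightarrow> bool" where
  "irregular_cusp0 G D \<Gamma> I \<longleftrightarrow> U_cusp0 G D I \<inter> \<Gamma> \<noteq> U_cusp0 G D I \<inter> with_neg_id G D \<Gamma>"

definition irregular_cusp1 ::
    "int^'n^'n \<Rightarrow> (complex^'n) set set \<Rightarrow> (rat^'n^'n) set \<Rightarrow> (rat^'n) set \<Rightarrow> bool" where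
  "irregular_cusp1 G D \<Gamma> J \<longleftrightarrow> U_cusp1 G D J \<inter> \<Gamma> \<noteq> U_cusp1 G D J \<inter> with_neg_id G D \<Gamma>"

definition no_irregular_cusp ::
    "int^'n^'n \<Rightarrow> (complex^'n) set set \<Rightarrow> (rat^'n^'n) set \<Rightarrow> bool" where
  "no_irregular_cusp G D \<Gamma> \<longleftrightarrow>
     (\<forall>I. cusp G 1 I \<longrightarrow> \<not> irregular_cusp0 G D \<Gamma> I) \<and>
     (\<forall>J. cusp G 2 J \<longrightarrow> \<not> irregular_cusp1 G D \<Gamma> J)"

end

theory Submission
  imports Defs
begin

text \<open>
  Since \<open>-id\<close> is a central involution, the group generated by \<open>\<Gamma>\<close> and \<open>-id\<close> is
  \<open>\<Gamma> \<union> -\<Gamma>\<close> (lemma \<open>with_neg_id_subset\<close>). An irregular cusp therefore produces an element \<open>g\<close> of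
  the unipotent group of the cusp such that \<open>g \<notin> \<Gamma>\<close> but \<open>-g \<in> \<Gamma>\<close>. If \<open>-id \<in> \<Gamma>\<close>, this is absurd.

  In the other two cases the eigenvalues \<open>1\<close> and \<open>-1\<close> of \<open>g\<close> decide. On the one hand, \<open>g\<close> fixes
  the nonzero vectors of the cusp, so \<open>-1\<close> is an eigenvalue of \<open>-g\<close>; it is a nontrivial torsion
  element of the multiplicative group, hence \<open>\<Gamma>\<close> is not neat. On the other hand, \<open>g\<close> is unipotent,
  so \<open>-1\<close> is not an eigenvalue of \<open>g\<close> (lemmas \<open>U_cusp0_no_neg_eigenvector\<close> and
  \<open>U_cusp1_no_neg_eigenvector\<close>). For an isometry \<open>g\<close> of a nondegenerate form, \<open>det g = -1\<close> forces
  the eigenvalue \<open>-1\<close> (lemma \<open>isometry_det_neg_one_eigenvector\<close>), so \<open>det g \<noteq> -1\<close>. But when \<open>b\<close> is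
  odd, the rank \<open>2 + b\<close> is odd, and \<open>-g \<in> SO\<close> would mean \<open>det g = -1\<close>. This use of the eigenvalue
  \<open>-1\<close> replaces a computation of the determinant of a unipotent matrix.
\<close>

section \<open>The bilinear form and its Gram matrix\<close>

definition gram :: "int^'n^'n \<Rightarrow> 'a::comm_ring_1^'n^'n" where
  "gram G = (\<chi> i j. of_int (G $ i $ j))"

lemma bform_gram: "bform G x y = (\<Sum>i\<in>UNIV. x $ i * (gram G *v y) $ i)"
  by (simp add: bform_def gram_def matrix_vector_mult_def sum_distrib_left mult.assoc)

lemma bform_add_left: "bform G (x + y) z = bform G x z + bform G y z"
  by (simp add: bform_def algebra_simps sum.distrib)

lemma bform_minus_left: "bform G (- x) z = - bform G x z"
  by (simp add: bform_def sum_negf)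

lemma bform_scale_left: "bform G (c *s x) z = c * bform G x z"
  by (simp add: bform_def sum_distrib_left mult.assoc)

lemma bform_scale_right: "bform G x (c *s z) = c * bform G x z"
  by (simp add: bform_def sum_distrib_left algebra_simps)

lemma bform_add_right: "bform G x (y + z) = bform G x y + bform G x z"
  by (simp add: bform_def algebra_simps sum.distrib)

lemma bform_0_left [simp]: "bform G 0 x = 0"
  and bform_0_right [simp]: "bform G x 0 = 0"
  by (simp_all add: bform_def)

lemma bform_axis_left: "bform G (axis i 1) y = (gram G *v y) $ i"
proof -
  have "bform G (axis i 1) y = (\<Sum>k\<in>UNIV. if k = i then (gram G *v y) $ k else 0)"
    unfolding bform_gram by (rule sum.cong) (auto simp: axis_def)
  then show ?thesis by simp
qed

lemma gram_congruence_entry: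
  "bform G (A *v axis i 1) (B *v axis j 1) = (transpose A ** gram G ** B) $ i $ j"
proof -
  have A: "A *v axis i 1 = column i A" and B: "B *v axis j 1 = column j B"
    by (simp_all add: matrix_vector_mult_def column_def axis_def vec_eq_iff if_distrib cong: if_cong)
  have "bform G (column i A) (column j B)
      = (\<Sum>k\<in>UNIV. \<Sum>l\<in>UNIV. A $ k $ i * of_int (G $ k $ l) * B $ l $ j)"
    by (simp add: bform_def column_def)
  also have "\<dots> = (\<Sum>l\<in>UNIV. \<Sum>k\<in>UNIV. A $ k $ i * of_int (G $ k $ l) * B $ l $ j)"
    by (rule sum.swap)
  also have "\<dots> = (transpose A ** gram G ** B) $ i $ j"
    by (simp add: matrix_matrix_mult_def transpose_def gram_def sum_distrib_right)
  finally show ?thesis by (simp add: A B)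
qed

lemma det_eq_0_iff_kernel:
  fixes A :: "'a::field^'n^'n"
  shows "det A = 0 \<longleftrightarrow> (\<exists>x. x \<noteq> 0 \<and> A *v x = 0)"
  using invertible_det_nz[of A] invertible_left_inverse[of A] matrix_left_invertible_ker[of A]
  by blast

lemma common_denominator:
  fixes x :: "rat^'n"
  shows "\<exists>(d::int) y :: int^'n. d \<noteq> 0 \<and> (\<forall>i. of_int d * x $ i = of_int (y $ i))"
proof -
  define q where "q i = snd (quotient_of (x $ i))" for i
  have pos: "q i > 0" for i
    unfolding q_def by (rule quotient_of_denom_pos')
  have xi: "of_int (q i) * x $ i = of_int (fst (quotient_of (x $ i)))" for i
  proof -
    have "x $ i = of_int (fst (quotient_of (x $ i))) / of_int (q i)"
      unfolding q_def by (rule quotient_of_div) simp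
    then show ?thesis
      using pos[of i] by (metis nonzero_mult_div_cancel_left of_int_eq_0_iff order_less_irrefl
          times_divide_eq_right)
  qed
  have "of_int (prod q UNIV) * x $ i
      = of_int (prod q (UNIV - {i}) * fst (quotient_of (x $ i)))" for i
    using xi[of i] by (subst prod.remove[of UNIV i]) (simp_all add: mult_ac)
  moreover have "prod q UNIV \<noteq> 0" using pos by (simp add: prod_pos less_imp_neq[symmetric])
  ultimately show ?thesis
    by (intro exI[of _ "prod q UNIV"]
        exI[of _ "\<chi> i. prod q (UNIV - {i}) * fst (quotient_of (x $ i))"]) simp
qed

lemma det_gram_of_int: "det (gram G :: 'a::comm_ring_1^'n^'n) = of_int (det G)"
  by (simp add: det_def gram_def)

text \<open>A kernel vector of the Gram matrix over the rationals becomes, after clearing denominators,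
  an integral vector in the radical. The determinant is an integer, so that its nonvanishing
  passes from the rationals to all fields of characteristic zero.\<close>

lemma det_gram_nonzero:
  fixes G :: "int^'n^'n"
  assumes "lattice_form G"
  shows "det (gram G :: 'a::field_char_0^'n^'n) \<noteq> 0"
proof -
  have "det (gram G :: rat^'n^'n) \<noteq> 0"
  proof
    assume "det (gram G :: rat^'n^'n) = 0"
    then obtain x :: "rat^'n" where x: "x \<noteq> 0" "gram G *v x = 0"
      using det_eq_0_iff_kernel by blast
    obtain d and y :: "int^'n" where d: "d \<noteq> 0" "\<And>i. of_int d * x $ i = of_int (y $ i)"
      using common_denominator by blast
    have "bform G y z = 0" for z
    proof -
      define z' :: "rat^'n" where "z' = (\<chi> i. of_int (z $ i))"
      have "of_int (bform G z y) = bform G z' (of_int d *s x)"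
        by (simp add: bform_def z'_def d(2))
      also have "\<dots> = of_int d * bform G z' x" by (rule bform_scale_right)
      also have "\<dots> = 0" by (simp add: bform_gram x(2))
      finally have "bform G z y = 0" by simp
      then show ?thesis using assms unfolding lattice_form_def by metis
    qed
    then have "y = 0" using assms unfolding lattice_form_def by blast
    then have "x = 0" using d by (simp add: vec_eq_iff)
    then show False using x by simp
  qed
  then show ?thesis by (simp add: det_gram_of_int)
qed

text \<open>A null vector in an orthogonal basis would be orthogonal to everything, so every basis vector
  has positive or negative square.\<close>

lemma card_eq_signature_sum:
  fixes G :: "int^'n^'n"
  assumes L: "lattice_form G" and sig: "has_signature G p q"
  shows "CARD('n) = p + q"
proof -
  obtain e :: "'n \<Rightarrow> real^'n" where inj: "inj e" and ind: "independent (range e)"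
    and orth: "\<And>i j. i \<noteq> j \<Longrightarrow> bform G (e i) (e j) = 0"
    and p: "card {i. bform G (e i) (e i) > 0} = p"
    and q: "card {i. bform G (e i) (e i) < 0} = q"
    using sig unfolding has_signature_def by blast
  have "UNIV \<subseteq> span (range e)"
    using card_ge_dim_independent[of "range e" UNIV] ind inj by (simp add: card_image)
  have nz: "bform G (e i) (e i) \<noteq> 0" for i
  proof
    assume "bform G (e i) (e i) = 0"
    then have range: "bform G y (e i) = 0" if "y \<in> range e" for y
      using orth that by (metis image_iff)
    have perp: "bform G y (e i) = 0" for y
    proof -
      have "y \<in> span (range e)" using \<open>UNIV \<subseteq> span (range e)\<close> by blast
      then show ?thesis
        by (induction rule: span_induct_alt)
          (simp_all add: bform_add_left bform_scale_left range flip: scalar_mult_eq_scaleR)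
    qed
    have "gram G *v e i = 0"
      using bform_axis_left[of G _ "e i"] by (simp add: vec_eq_iff perp)
    then have "e i = 0"
      using det_gram_nonzero[OF L, where ?'a = real] det_eq_0_iff_kernel by blast
    then show False using ind by (metis dependent_zero rangeI)
  qed
  have "UNIV = {i. bform G (e i) (e i) > 0} \<union> {i. bform G (e i) (e i) < 0}"
    using nz by (auto simp: neq_iff)
  then have "CARD('n) = card ({i. bform G (e i) (e i) > 0} \<union> {i. bform G (e i) (e i) < 0})"
    by simp
  also have "\<dots> = p + q"
    using p q by (subst card_Un_disjoint) auto
  finally show ?thesis .
qed


section \<open>Isometries and the eigenvalue minus one\<close>

lemma orth_Q_gram:
  assumes "g \<in> orth_Q G"
  shows "transpose g ** gram G ** g = gram G"
proof -
  have "(transpose g ** gram G ** g) $ i $ j = gram G $ i $ j" for i j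
  proof -
    have "bform G (g *v axis i 1) (g *v axis j 1) = bform G (axis i 1) (axis j 1)"
      using assms by (simp add: orth_Q_def)
    then show ?thesis
      using gram_congruence_entry[of G g i g j] gram_congruence_entry[of G "mat 1" i "mat 1" j]
      by (simp add: transpose_mat)
  qed
  then show ?thesis by (simp add: vec_eq_iff)
qed

lemma matrix_add_distrib_right: "(A + B) ** C = A ** C + B ** C"
  for A :: "'a::comm_ring_1^'n^'m"
  by (simp add: matrix_matrix_mult_def vec_eq_iff sum.distrib algebra_simps)

text \<open>The isometry relation says \<open>g\<^sup>T G (1 + g) = (1 + g)\<^sup>T G\<close>. Taking determinants gives
  \<open>det g det (1 + g) = det (1 + g)\<close>, so \<open>1 + g\<close> is singular when \<open>det g = -1\<close>.\<close>

lemma isometry_det_neg_one_eigenvector: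
  fixes G :: "int^'n^'n" and g :: "rat^'n^'n"
  assumes "lattice_form G" and "g \<in> orth_Q G" and "det g = - 1"
  shows "\<exists>v. v \<noteq> 0 \<and> g *v v = - v"
proof -
  let ?G = "gram G :: rat^'n^'n"
  have tr: "transpose (mat 1 + g) = mat 1 + transpose g"
    by (simp add: vec_eq_iff transpose_def mat_def)
  have "transpose g ** ?G ** (mat 1 + g) = transpose (mat 1 + g) ** ?G"
    unfolding tr using orth_Q_gram[OF assms(2)]
    by (simp add: matrix_add_ldistrib matrix_add_distrib_right add.commute)
  then have "det (transpose g ** ?G ** (mat 1 + g)) = det (transpose (mat 1 + g) ** ?G)"
    by (rule arg_cong)
  then have "det (mat 1 + g) = 0"
    using det_gram_nonzero[OF assms(1), where ?'a = rat] assms(3)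
    by (simp add: det_mul det_transpose)
  then obtain v where "v \<noteq> 0" "(mat 1 + g) *v v = 0"
    using det_eq_0_iff_kernel by blast
  then show ?thesis
    by (metis add_eq_0_iff matrix_vector_mul_lid matrix_vector_mult_add_rdistrib)
qed

lemma det_uminus: "det (- A) = (- 1) ^ CARD('n) * det (A :: 'a::comm_ring_1^'n^'n)"
proof -
  have "det (- A) = (\<Sum>p | p permutes (UNIV :: 'n set).
      of_int (sign p) * ((- 1) ^ CARD('n) * (\<Prod>i\<in>UNIV. A $ i $ p i)))"
    by (simp add: det_def prod_uminus)
  then show ?thesis by (simp add: det_def sum_distrib_left mult.left_commute)
qed


section \<open>Unipotent groups of cusps\<close>

lemma matrix_vector_uminus_left: "(- A) *v x = - (A *v x)" for A :: "'a::comm_ring_1^'n^'m"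
  by (simp add: matrix_vector_mult_def vec_eq_iff sum_negf)

lemma fixes_span:
  fixes g :: "'a::field^'n^'n"
  assumes "\<forall>x\<in>I. g *v x = x" and "y \<in> vec.span I"
  shows "g *v y = y"
  using assms(2)
  by (induction rule: vec.span_induct_alt)
    (simp_all add: assms(1) matrix_vector_right_distrib vec.scale)

lemma isotropic_imp_perp:
  assumes "isotropic G I" and "v \<in> vec.span I"
  shows "v \<in> perp_Q G I"
proof -
  have right: "bform G u w = 0" if "u \<in> I" "w \<in> vec.span I" for u w
    using that(2)
    by (induction rule: vec.span_induct_alt)
      (use assms(1) that(1) in \<open>simp_all add: isotropic_def bform_add_right bform_scale_right\<close>)
  have "bform G v w = 0" if "w \<in> vec.span I" for w
    using assms(2)
    by (induction rule: vec.span_induct_alt)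
      (simp_all add: right that bform_add_left bform_scale_left)
  then show ?thesis by (simp add: perp_Q_def)
qed

lemma cusp_nonzero_vector:
  assumes "cusp G r I" and "r > 0"
  shows "\<exists>x\<in>I. x \<noteq> 0"
proof (rule ccontr)
  assume "\<not> ?thesis"
  then have "I \<subseteq> {0}" by blast
  then have "vec.dim I = 0" by (metis vec.dim_eq_0)
  then show False using assms by (simp add: cusp_def del: vec.dim_eq_0)
qed

text \<open>The vector \<open>g v - v\<close> is orthogonal to whatever \<open>g\<close> fixes, and here it is \<open>-2 v\<close>.\<close>

lemma neg_eigenvector_orthogonal_fixed:
  fixes v w :: "rat^'n"
  assumes "g \<in> orth_Q G" and "g *v v = - v" and "g *v w = w"
  shows "bform G v w = 0"
proof -
  have "bform G v w = bform G (g *v v) (g *v w)" using assms(1) by (simp add: orth_Q_def)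
  also have "\<dots> = - bform G v w" using assms(2,3) by (simp add: bform_minus_left)
  finally show ?thesis by simp
qed

lemma neg_fixed_imp_zero:
  fixes v :: "rat^'n"
  assumes "g *v v = - v" and "g *v v = v"
  shows "v = 0"
  using assms by (simp add: vec_eq_iff)

text \<open>An eigenvector for \<open>-1\<close> descends the filtration of the rational space by \<open>I\<^sup>\<bottom>\<close> and the
  span of \<open>I\<close>, on whose graded pieces \<open>g\<close> is trivial: it lies in \<open>I\<^sup>\<bottom>\<close>, then in the span of \<open>I\<close>, and then it is zero.\<close>

lemma U_cusp0_no_neg_eigenvector:
  fixes v :: "rat^'n"
  assumes "g \<in> U_cusp0 G D I" and neg: "g *v v = - v"
  shows "v = 0"
proof -
  have orth: "g \<in> orth_Q G" and fix_I: "\<forall>x\<in>I. g *v x = x"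
    and quot: "\<And>u. u \<in> perp_Q G I \<Longrightarrow> g *v u - u \<in> vec.span I"
    using assms(1) by (auto simp: U_cusp0_def orth_plus_Q_def)
  have "v \<in> perp_Q G I"
    using neg_eigenvector_orthogonal_fixed[OF orth neg] fixes_span[OF fix_I]
    by (simp add: perp_Q_def)
  then have "- v - v \<in> vec.span I" using quot[of v] neg by simp
  then have "(- 1 / 2) *s (- v - v) \<in> vec.span I" by (rule vec.span_scale)
  also have "(- 1 / 2) *s (- v - v) = v" by (simp add: vec_eq_iff)
  finally have "g *v v = v" using fixes_span[OF fix_I] by blast
  then show ?thesis using neg neg_fixed_imp_zero by blast
qed

text \<open>Here isotropy of \<open>J\<close> enters: \<open>v\<close> is orthogonal to \<open>J\<^sup>\<bottom>\<close>, hence to \<open>J\<close>, which puts it in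
  \<open>J\<^sup>\<bottom>\<close>, where \<open>g\<close> is trivial.\<close>

lemma U_cusp1_no_neg_eigenvector:
  fixes v :: "rat^'n"
  assumes "g \<in> U_cusp1 G D J" and "isotropic G J" and neg: "g *v v = - v"
  shows "v = 0"
proof -
  have orth: "g \<in> orth_Q G" and fix_perp: "\<And>u. u \<in> perp_Q G J \<Longrightarrow> g *v u = u"
    using assms(1) by (auto simp: U_cusp1_def orth_plus_Q_def)
  have "v \<in> perp_Q G J"
    using neg_eigenvector_orthogonal_fixed[OF orth neg] fix_perp isotropic_imp_perp[OF assms(2)]
    by (simp add: perp_Q_def)
  then show ?thesis using fix_perp neg neg_fixed_imp_zero by blast
qed


section \<open>Adjoining minus the identity\<close>

lemma matrix_mult_minus_left: "(- A) ** B = - (A ** B)" for A :: "'a::comm_ring_1^'n^'m"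
  by (simp add: matrix_matrix_mult_def vec_eq_iff sum_negf)

lemma matrix_mult_minus_right: "A ** (- B) = - (A ** B)" for A :: "'a::comm_ring_1^'n^'m"
  by (simp add: matrix_matrix_mult_def vec_eq_iff sum_negf)

lemma neg_id_preserves_domain:
  fixes D :: "(complex^'n) set set"
  assumes "period_domain G D"
  shows "preserves_domain D (- mat 1)"
proof -
  have "cmat (- mat 1) *v v = - v" for v :: "complex^'n"
  proof -
    have "cmat (- mat 1) = (- mat 1 :: complex^'n^'n)"
      by (simp add: cmat_def vec_eq_iff mat_def)
    then show ?thesis by (simp add: matrix_vector_uminus_left)
  qed
  moreover have "uminus ` l = l" if "l \<in> D" for l
  proof -
    have "D \<subseteq> period_quadric G"
      using assms connected_components_of_subset unfolding period_domain_def by fastforce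
    then obtain \<omega> where "l = vec.span {\<omega>}"
      using \<open>l \<in> D\<close> unfolding period_quadric_def by blast
    then have neg: "- x \<in> l" if "x \<in> l" for x using that vec.span_neg by blast
    show ?thesis
    proof
      show "l \<subseteq> uminus ` l" using neg by (metis add.inverse_inverse image_eqI subsetI)
    qed (use neg in blast)
  qed
  ultimately show ?thesis by (simp add: preserves_domain_def)
qed

lemma neg_id_in_orth_plus_L:
  fixes G :: "int^'n^'n"
  assumes "period_domain G D"
  shows "- mat 1 \<in> orth_plus_L G D"
proof -
  have "(- mat 1 :: rat^'n^'n) ** - mat 1 = mat 1"
    by (simp add: matrix_mult_minus_left matrix_mult_minus_right)
  then have "invertible (- mat 1 :: rat^'n^'n)" unfolding invertible_def by blast
  moreover have "bform G (- x) (- y) = bform G x y" for x y :: "rat^'n"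
    by (simp add: bform_def)
  moreover have "uminus ` (lat :: (rat^'n) set) = lat"
  proof
    show "lat \<subseteq> uminus ` (lat :: (rat^'n) set)"
    proof
      fix x :: "rat^'n" assume "x \<in> lat"
      then have "- x \<in> lat" by (simp add: lat_def)
      then show "x \<in> uminus ` lat" by (metis add.inverse_inverse image_eqI)
    qed
  qed (auto simp: lat_def)
  ultimately show ?thesis
    using neg_id_preserves_domain[OF assms]
    by (simp add: orth_plus_L_def orth_L_def orth_Q_def matrix_vector_uminus_left)
qed

lemma inv_neg_id:
  assumes "- mat 1 \<in> S"
  shows "inv\<^bsub>mat_group S\<^esub> (- mat 1) = - mat 1"
  unfolding m_inv_def
proof (rule the_equality)
  fix y assume "y \<in> carrier (mat_group S) \<and>
      - mat 1 \<otimes>\<^bsub>mat_group S\<^esub> y = \<one>\<^bsub>mat_group S\<^esub> \<and> y \<otimes>\<^bsub>mat_group S\<^esub> - mat 1 = \<one>\<^bsub>mat_group S\<^esub>"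
  then have "- y = mat 1" by (simp add: mat_group_def matrix_mult_minus_left)
  then show "y = - mat 1" by (metis add.inverse_inverse)
qed (use assms in \<open>simp add: mat_group_def matrix_mult_minus_left matrix_mult_minus_right\<close>)

lemma with_neg_id_subset:
  assumes dom: "period_domain G D"
    and sub: "subgroup \<Gamma> (mat_group (orth_plus_L G D))"
    and "h \<in> with_neg_id G D \<Gamma>"
  shows "h \<in> \<Gamma> \<or> - h \<in> \<Gamma>"
proof -
  have one: "mat 1 \<in> \<Gamma>" using subgroup.one_closed[OF sub] by (simp add: mat_group_def)
  have mult: "a ** b \<in> \<Gamma>" if "a \<in> \<Gamma>" "b \<in> \<Gamma>" for a b
    using subgroup.m_closed[OF sub that] by (simp add: mat_group_def)
  have "h \<in> generate (mat_group (orth_plus_L G D)) (insert (- mat 1) \<Gamma>)"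
    using assms(3) by (simp add: with_neg_id_def)
  then show ?thesis
  proof induction
    case one
    then show ?case using \<open>mat 1 \<in> \<Gamma>\<close> by (simp add: mat_group_def)
  next
    case (incl h)
    then show ?case using one by auto
  next
    case (inv h)
    then show ?case
      using one inv_neg_id[OF neg_id_in_orth_plus_L[OF dom]] subgroup.m_inv_closed[OF sub] by auto
  next
    case (eng h1 h2)
    have "h1 ** h2 = - h1 ** - h2" "- (h1 ** h2) = - h1 ** h2" "- (h1 ** h2) = h1 ** - h2"
      by (simp_all add: matrix_mult_minus_left matrix_mult_minus_right)
    then have "h1 ** h2 \<in> \<Gamma> \<or> - (h1 ** h2) \<in> \<Gamma>" using eng.IH mult by metis
    then show ?case by (simp add: mat_group_def)
  qed
qed


section \<open>Excluding irregular cusps\<close>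

lemma neat_no_neg_eigenvector:
  fixes x :: "rat^'n"
  assumes "neat \<Gamma>" and "\<gamma> \<in> \<Gamma>" and "x \<noteq> 0"
  shows "\<gamma> *v x \<noteq> - x"
proof
  assume eq: "\<gamma> *v x = - x"
  define w :: "complex^'n" where "w = (\<chi> i. of_rat (x $ i))"
  have "w \<noteq> 0" using assms(3) by (simp add: w_def vec_eq_iff)
  have "(cmat \<gamma> *v w) $ i = (- 1 *s w) $ i" for i
  proof -
    have "(cmat \<gamma> *v w) $ i = of_rat ((\<gamma> *v x) $ i)"
      by (simp add: cmat_def w_def matrix_vector_mult_def of_rat_sum of_rat_mult)
    then show ?thesis by (simp add: eq w_def of_rat_minus)
  qed
  then have "cmat \<gamma> *v w = - 1 *s w" by (simp add: vec_eq_iff)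
  then have "- 1 \<in> eigenvalues \<gamma>" using \<open>w \<noteq> 0\<close> unfolding eigenvalues_def by blast
  then have "- 1 \<in> generate complex_units (eigenvalues \<gamma>)" by (rule generate.incl)
  moreover have "(- 1) [^]\<^bsub>complex_units\<^esub> (2::nat) = \<one>\<^bsub>complex_units\<^esub>"
    by (simp add: nat_pow_def complex_units_def numeral_2_eq_2)
  moreover have "torsion_free complex_units (generate complex_units (eigenvalues \<gamma>))"
    using assms(1,2) by (simp add: neat_def)
  ultimately have "- 1 = \<one>\<^bsub>complex_units\<^esub>"
    unfolding torsion_free_def by (metis pos2)
  then show False by (simp add: complex_units_def)
qed

text \<open>The argument that serves both kinds of cusp: \<open>U\<close> stands for the unipotent group of the cusp.
  Its eigenvalue \<open>1\<close> contradicts neatness, and the absence of \<open>-1\<close> contradicts \<open>det (-g) = 1\<close> in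
  odd rank.\<close>

lemma inter_with_neg_id_eq:
  fixes G :: "int^'n^'n"
  assumes L: "lattice_form G" and sig: "has_signature G 2 b" and dom: "period_domain G D"
    and sub: "subgroup \<Gamma> (mat_group (orth_plus_L G D))"
    and cases: "- mat 1 \<in> \<Gamma> \<or> neat \<Gamma> \<or> (\<Gamma> \<subseteq> sorth_plus_L G D \<and> odd b)"
    and U: "U \<subseteq> orth_Q G"
    and fixed: "\<And>g. g \<in> U \<Longrightarrow> \<exists>x. x \<noteq> 0 \<and> g *v x = x"
    and no_neg: "\<And>g v. g \<in> U \<Longrightarrow> g *v v = - v \<Longrightarrow> v = 0"
  shows "U \<inter> \<Gamma> = U \<inter> with_neg_id G D \<Gamma>"
proof -
  have "g \<in> \<Gamma>" if g: "g \<in> U" "g \<in> with_neg_id G D \<Gamma>" for g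
  proof (rule ccontr)
    assume "g \<notin> \<Gamma>"
    then have neg: "- g \<in> \<Gamma>" using with_neg_id_subset[OF dom sub g(2)] by blast
    from cases consider "- mat 1 \<in> \<Gamma>" | "neat \<Gamma>" | "\<Gamma> \<subseteq> sorth_plus_L G D" "odd b" by blast
    then show False
    proof cases
      case 1
      then have "- mat 1 ** - g \<in> \<Gamma>"
        using subgroup.m_closed[OF sub 1 neg] by (simp add: mat_group_def)
      then show False
        using \<open>g \<notin> \<Gamma>\<close> by (simp add: matrix_mult_minus_left)
    next
      case 2
      obtain x where "x \<noteq> 0" "g *v x = x" using fixed g(1) by blast
      then show False
        using neat_no_neg_eigenvector[OF 2 neg] by (simp add: matrix_vector_uminus_left)
    next
      case 3
      have "odd CARD('n)" using card_eq_signature_sum[OF L sig] 3(2) by simp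
      moreover have "det (- g) = 1"
        using neg 3(1) by (auto simp: sorth_plus_L_def sorth_L_def)
      ultimately have "det g = - 1" by (simp add: det_uminus)
      then show False
        using isometry_det_neg_one_eigenvector[OF L, of g] U g(1) no_neg by blast
    qed
  qed
  moreover have "\<Gamma> \<subseteq> with_neg_id G D \<Gamma>"
    by (auto simp: with_neg_id_def intro: generate.incl)
  ultimately show ?thesis by blast
qed

theorem corollary3p4:
  fixes G :: "int^'n^'n" and b :: nat
    and D :: "(complex^'n) set set" and \<Gamma> :: "(rat^'n^'n) set"
  assumes "lattice_form G" and "has_signature G 2 b"
    and "period_domain G D"
    and "subgroup \<Gamma> (mat_group (orth_plus_L G D))"
    and "finite (rcosets\<^bsub>mat_group (orth_plus_L G D)\<^esub> \<Gamma>)"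
    and "- mat 1 \<in> \<Gamma> \<or> neat \<Gamma> \<or> (\<Gamma> \<subseteq> sorth_plus_L G D \<and> odd b)"
  shows "no_irregular_cusp G D \<Gamma>"
  unfolding no_irregular_cusp_def irregular_cusp0_def irregular_cusp1_def not_not
proof (intro conjI allI impI)
  fix I assume I: "cusp G 1 I"
  then obtain x where x: "x \<in> I" "x \<noteq> 0" using cusp_nonzero_vector[OF I] by auto
  show "U_cusp0 G D I \<inter> \<Gamma> = U_cusp0 G D I \<inter> with_neg_id G D \<Gamma>"
  proof (rule inter_with_neg_id_eq[OF assms(1-4,6)])
    show "U_cusp0 G D I \<subseteq> orth_Q G" by (auto simp: U_cusp0_def orth_plus_Q_def)
    show "\<exists>x. x \<noteq> 0 \<and> g *v x = x" if "g \<in> U_cusp0 G D I" for g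
      using that x by (auto simp: U_cusp0_def)
  qed (rule U_cusp0_no_neg_eigenvector)
next
  fix J assume J: "cusp G 2 J"
  then obtain x where x: "x \<in> J" "x \<noteq> 0" using cusp_nonzero_vector[OF J] by auto
  have iso: "isotropic G J" using J by (simp add: cusp_def)
  show "U_cusp1 G D J \<inter> \<Gamma> = U_cusp1 G D J \<inter> with_neg_id G D \<Gamma>"
  proof (rule inter_with_neg_id_eq[OF assms(1-4,6)])
    show "U_cusp1 G D J \<subseteq> orth_Q G" by (auto simp: U_cusp1_def orth_plus_Q_def)
    show "\<exists>x. x \<noteq> 0 \<and> g *v x = x" if "g \<in> U_cusp1 G D J" for g
      using that x isotropic_imp_perp[OF iso vec.span_base[OF x(1)]] by (auto simp: U_cusp1_def)
  qed (rule U_cusp1_no_neg_eigenvector[OF _ iso])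
qed

end
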